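(* For every integer $n\geq 9$ with $n\equiv 2 \pmod 7$, there exists a simple plane graph $G$ on $n$ vertices containing neither $K_4$ nor $C_5$ as a subgraph such that $e(G)=\frac{15}{7}(n-2)$.
   Context: $K_4$ is the complete graph on $4$ vertices, $C_5$ the cycle on $5$ vertices; $e(G)$ is the number of edges of $G$. *)

theory Defs
  imports "HOL-Analysis.Analysis"
begin

definition simple_graph :: "'a set \<Rightarrow> 'a set set \<Rightarrow> bool" where
  "simple_graph V E \<longleftrightarrow> finite V \<and> (\<forall>e\<in>E. e \<subseteq> V \<and> card e = 2)"

definition plane_embedding ::
  "'a set \<Rightarrow> 'a set set \<Rightarrow> ('a \<Rightarrow> complex) \<Rightarrow> ('a set \<Rightarrow> real \<Rightarrow> complex) \<Rightarrow> bool" where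
  "plane_embedding V E p \<gamma> \<longleftrightarrow>
     inj_on p V \<and>
     (\<forall>e\<in>E. arc (\<gamma> e) \<and> {pathstart (\<gamma> e), pathfinish (\<gamma> e)} = p ` e \<and>
             path_image (\<gamma> e) \<inter> p ` V = p ` e) \<and>
     (\<forall>e\<in>E. \<forall>e'\<in>E. e \<noteq> e' \<longrightarrow> path_image (\<gamma> e) \<inter> path_image (\<gamma> e') \<subseteq> p ` (e \<inter> e'))"

definition planar_graph :: "'a set \<Rightarrow> 'a set set \<Rightarrow> bool" where
  "planar_graph V E \<longleftrightarrow> (\<exists>p \<gamma>. plane_embedding V E p \<gamma>)"

definition contains_K4 :: "'a set \<Rightarrow> 'a set set \<Rightarrow> bool" where
  "contains_K4 V E \<longleftrightarrow> (\<exists>S\<subseteq>V. card S = 4 \<and> (\<forall>x\<in>S. \<forall>y\<in>S. x \<noteq> y \<longrightarrow> {x, y} \<in> E))"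

definition contains_C5 :: "'a set \<Rightarrow> 'a set set \<Rightarrow> bool" where
  "contains_C5 V E \<longleftrightarrow> (\<exists>v :: nat \<Rightarrow> 'a. inj_on v {0..<5} \<and> v ` {0..<5} \<subseteq> V \<and>
      (\<forall>i<5. {v i, v ((i + 1) mod 5)} \<in> E))"

end

theory Submission
  imports Defs
begin

text \<open>
  A diamond is \<open>K\<^sub>4\<close> minus an edge. Three diamonds joined in a ring at their vertices of degree
  two form a plane graph with 9 vertices and 15 edges whose outer face is a hexagon. Glue \<open>k\<close>
  copies of it at two opposite vertices of that hexagon: this gives \<open>7k + 2\<close> vertices and \<open>15k\<close>
  edges. The graph is bipartite once the diagonals of the diamonds are removed, so every \<open>K\<^sub>4\<close>
  and every \<open>C\<^sub>5\<close> contains a diagonal. If \<open>x \<noteq> y\<close> are further neighbours of the two ends of a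
  diagonal, one of each, then \<open>x\<close> and \<open>y\<close> are non-adjacent and have no common neighbours except
  these ends, which excludes \<open>K\<^sub>4\<close> and \<open>C\<^sub>5\<close>.

  For planarity, the vertices are placed on four vertical lines so that edges are segments that
  join vertical neighbours or consecutive lines in an order-preserving way.
\<close>

subsection \<open>Embeddings of graphs\<close>

definition graph_embedding ::
  "('a \<Rightarrow> 'b) \<Rightarrow> 'a set \<Rightarrow> 'a set set \<Rightarrow> 'b set \<Rightarrow> 'b set set \<Rightarrow> bool" where
  "graph_embedding f V E V' E' \<longleftrightarrow> inj_on f V \<and> f ` V \<subseteq> V' \<and> (\<forall>e\<in>E. f ` e \<in> E')"

lemma graph_embedding_contains_K4:
  assumes f: "graph_embedding f V E V' E'" and "contains_K4 V E"
  shows "contains_K4 V' E'"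
proof -
  obtain S where S: "S \<subseteq> V" "card S = 4"
    and clique: "\<And>x y. \<lbrakk>x \<in> S; y \<in> S; x \<noteq> y\<rbrakk> \<Longrightarrow> {x, y} \<in> E"
    using \<open>contains_K4 V E\<close> by (auto simp: contains_K4_def)
  have "f ` S \<subseteq> V'"
    using f S(1) unfolding graph_embedding_def by blast
  moreover have "card (f ` S) = 4"
    using f S by (auto simp: graph_embedding_def card_image inj_on_subset)
  moreover have "{f x, f y} \<in> E'" if "x \<in> S" "y \<in> S" "f x \<noteq> f y" for x y
  proof -
    have "f ` {x, y} \<in> E'"
      using f clique[of x y] that unfolding graph_embedding_def by blast
    then show ?thesis by simp
  qed
  ultimately show ?thesis
    unfolding contains_K4_def by blast
qed

lemma graph_embedding_contains_C5:
  assumes f: "graph_embedding f V E V' E'" and "contains_C5 V E"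
  shows "contains_C5 V' E'"
proof -
  obtain v :: "nat \<Rightarrow> 'a" where v: "inj_on v {0..<5}" "v ` {0..<5} \<subseteq> V"
    and cycle: "\<And>i. i < 5 \<Longrightarrow> {v i, v ((i + 1) mod 5)} \<in> E"
    using \<open>contains_C5 V E\<close> unfolding contains_C5_def by blast
  have "inj_on f (v ` {0..<5})"
    using f v(2) unfolding graph_embedding_def by (blast intro: inj_on_subset)
  then have "inj_on (f \<circ> v) {0..<5}"
    using v(1) by (intro comp_inj_on)
  moreover have "(f \<circ> v) ` {0..<5} \<subseteq> V'"
    using f v(2) unfolding graph_embedding_def by fastforce
  moreover have "{(f \<circ> v) i, (f \<circ> v) ((i + 1) mod 5)} \<in> E'" if "i < 5" for i
  proof -
    have "f ` {v i, v ((i + 1) mod 5)} \<in> E'"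
      using f cycle[OF that] unfolding graph_embedding_def by blast
    then show ?thesis by simp
  qed
  ultimately show ?thesis
    unfolding contains_C5_def by blast
qed

lemma plane_embeddingI:
  assumes "simple_graph V E" and p: "inj_on p V"
    and arc: "\<And>e. e \<in> E \<Longrightarrow> arc (\<gamma> e)"
    and ends: "\<And>e. e \<in> E \<Longrightarrow> {pathstart (\<gamma> e), pathfinish (\<gamma> e)} = p ` e"
    and vertices: "\<And>e. e \<in> E \<Longrightarrow> path_image (\<gamma> e) \<inter> p ` V \<subseteq> p ` e"
    and meet: "\<And>e e'. \<lbrakk>e \<in> E; e' \<in> E; e \<noteq> e'\<rbrakk> \<Longrightarrow> path_image (\<gamma> e) \<inter> path_image (\<gamma> e') \<subseteq> p ` V"
  shows "plane_embedding V E p \<gamma>"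
  unfolding plane_embedding_def
proof (intro conjI ballI impI p arc ends)
  have E: "\<And>e. e \<in> E \<Longrightarrow> e \<subseteq> V"
    using \<open>simple_graph V E\<close> by (simp add: simple_graph_def)
  fix e assume e: "e \<in> E"
  have "p ` e \<subseteq> path_image (\<gamma> e)"
    unfolding ends[OF e, symmetric] by (simp add: pathstart_in_path_image pathfinish_in_path_image)
  moreover have "p ` e \<subseteq> p ` V"
    by (rule image_mono[OF E[OF e]])
  ultimately show "path_image (\<gamma> e) \<inter> p ` V = p ` e"
    using vertices[OF e] by (simp add: subset_antisym)
  fix e' assume e': "e' \<in> E" "e \<noteq> e'"
  have "path_image (\<gamma> e) \<inter> path_image (\<gamma> e') \<subseteq>
      (path_image (\<gamma> e) \<inter> p ` V) \<inter> (path_image (\<gamma> e') \<inter> p ` V)"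
    using meet[OF e e'] by simp
  also have "\<dots> \<subseteq> p ` e \<inter> p ` e'"
    by (rule Int_mono[OF vertices[OF e] vertices[OF e'(1)]])
  finally show "path_image (\<gamma> e) \<inter> path_image (\<gamma> e') \<subseteq> p ` (e \<inter> e')"
    by (simp only: inj_on_image_Int[OF p E[OF e] E[OF e'(1)]])
qed

lemma graph_embedding_planar_graph:
  assumes f: "graph_embedding f V E V' E'" and "simple_graph V E" and "planar_graph V' E'"
  shows "planar_graph V E"
proof -
  obtain p \<gamma> where "plane_embedding V' E' p \<gamma>"
    using \<open>planar_graph V' E'\<close> by (auto simp: planar_graph_def)
  then have p: "inj_on p V'"
    and arcs: "\<And>e. e \<in> E' \<Longrightarrow> arc (\<gamma> e) \<and> {pathstart (\<gamma> e), pathfinish (\<gamma> e)} = p ` e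
      \<and> path_image (\<gamma> e) \<inter> p ` V' = p ` e"
    and meet: "\<And>e e'. \<lbrakk>e \<in> E'; e' \<in> E'; e \<noteq> e'\<rbrakk>
      \<Longrightarrow> path_image (\<gamma> e) \<inter> path_image (\<gamma> e') \<subseteq> p ` (e \<inter> e')"
    unfolding plane_embedding_def by blast+
  have inj: "inj_on f V" and V': "f ` V \<subseteq> V'" and E': "\<And>e. e \<in> E \<Longrightarrow> f ` e \<in> E'"
    using f by (auto simp: graph_embedding_def)
  have E: "\<And>e. e \<in> E \<Longrightarrow> e \<subseteq> V"
    using \<open>simple_graph V E\<close> by (simp add: simple_graph_def)
  have comp_image: "(p \<circ> f) ` A = p ` f ` A" for A
    by (simp add: image_comp)
  have "plane_embedding V E (p \<circ> f) (\<lambda>e. \<gamma> (f ` e))"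
  proof (rule plane_embeddingI[OF \<open>simple_graph V E\<close>], unfold comp_image)
    show "inj_on (p \<circ> f) V"
      using comp_inj_on[OF inj inj_on_subset[OF p V']] .
  next
    fix e assume e: "e \<in> E"
    show "arc (\<gamma> (f ` e))" "{pathstart (\<gamma> (f ` e)), pathfinish (\<gamma> (f ` e))} = p ` f ` e"
      using arcs[OF E'[OF e]] by blast+
    have "path_image (\<gamma> (f ` e)) \<inter> p ` f ` V \<subseteq> path_image (\<gamma> (f ` e)) \<inter> p ` V'"
      by (intro Int_mono order_refl image_mono V')
    also have "\<dots> = p ` f ` e"
      using arcs[OF E'[OF e]] by (simp only:)
    finally show "path_image (\<gamma> (f ` e)) \<inter> p ` f ` V \<subseteq> p ` f ` e" .
  next
    fix e e' assume e: "e \<in> E" "e' \<in> E" "e \<noteq> e'"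
    then have "path_image (\<gamma> (f ` e)) \<inter> path_image (\<gamma> (f ` e')) \<subseteq> p ` (f ` e \<inter> f ` e')"
      using inj_on_image_eq_iff[OF inj] E by (intro meet E') simp_all
    also have "\<dots> \<subseteq> p ` f ` V"
      using E[OF e(1)] by (intro image_mono le_infI1)
    finally show "path_image (\<gamma> (f ` e)) \<inter> path_image (\<gamma> (f ` e')) \<subseteq> p ` f ` V" .
  qed
  then show ?thesis by (auto simp: planar_graph_def)
qed

lemma ex_graph_embedding_nat:
  fixes V :: "'a set"
  assumes "simple_graph V E"
  obtains V' :: "nat set" and E' f where "simple_graph V' E'" "card V' = card V" "card E' = card E"
    "graph_embedding f V' E' V E"
proof -
  obtain g :: "'a \<Rightarrow> nat" where g: "inj_on g V"
    using assms finite_imp_inj_to_nat_seg unfolding simple_graph_def by metis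
  have E: "\<And>e. e \<in> E \<Longrightarrow> e \<subseteq> V" "\<And>e. e \<in> E \<Longrightarrow> card e = 2" and "finite V"
    using assms by (auto simp: simple_graph_def)
  show thesis
  proof
    show "simple_graph (g ` V) ((`) g ` E)"
      using E \<open>finite V\<close> g by (auto simp: simple_graph_def card_image inj_on_subset)
    show "card (g ` V) = card V"
      using g by (rule card_image)
    have "E \<subseteq> Pow V"
      using E(1) by blast
    then show "card ((`) g ` E) = card E"
      using g by (metis card_image inj_on_image_Pow inj_on_subset)
    show "graph_embedding (inv_into V g) (g ` V) ((`) g ` E) V E"
      using g E(1) by (auto simp: graph_embedding_def inj_on_inv_into inv_into_image_cancel)
  qed
qed

subsection \<open>Monochromatic edges in two-coloured graphs\<close>

lemma contains_K4_monochromaticE: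
  fixes colour :: "'a \<Rightarrow> bool"
  assumes "contains_K4 V E"
  obtains a b x y where "colour a = colour b" "distinct [a, b, x, y]"
    "{a, b} \<in> E" "{a, x} \<in> E" "{a, y} \<in> E" "{b, x} \<in> E" "{b, y} \<in> E" "{x, y} \<in> E"
proof -
  obtain S where S: "card S = 4" and clique: "\<And>x y. \<lbrakk>x \<in> S; y \<in> S; x \<noteq> y\<rbrakk> \<Longrightarrow> {x, y} \<in> E"
    using assms by (auto simp: contains_K4_def)
  have "card (colour ` S) \<le> card (UNIV :: bool set)"
    by (intro card_mono) auto
  then have "\<not> inj_on colour S"
    using S by (intro pigeonhole) auto
  then obtain a b where ab: "a \<in> S" "b \<in> S" "a \<noteq> b" "colour a = colour b"
    by (auto simp: inj_on_def)
  then have "card (S - {a, b}) = 2"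
    using S by (simp add: card_Diff_subset)
  then obtain x y where xy: "S - {a, b} = {x, y}" "x \<noteq> y"
    by (auto simp: card_2_iff)
  then have "x \<in> S" "y \<in> S" "distinct [a, b, x, y]"
    using ab(3) by auto
  with ab show thesis
    by (intro that[of a b x y] clique) auto
qed

lemma contains_C5E:
  assumes "contains_C5 V E"
  obtains a b c d e where "distinct [a, b, c, d, e]"
    "{a, b} \<in> E" "{b, c} \<in> E" "{c, d} \<in> E" "{d, e} \<in> E" "{e, a} \<in> E"
proof -
  obtain v :: "nat \<Rightarrow> 'a" where inj: "inj_on v {0..<5}"
    and cycle: "\<And>i. i < 5 \<Longrightarrow> {v i, v ((i + 1) mod 5)} \<in> E"
    using assms unfolding contains_C5_def by blast
  have "distinct (map v [0, 1, 2, 3, 4])"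
    by (simp add: inj_on_eq_iff[OF inj])
  then show thesis
    using that[of "v 0" "v 1" "v 2" "v 3" "v 4"]
      cycle[of 0] cycle[of 1] cycle[of 2] cycle[of 3] cycle[of 4] by (simp add: numeral_2_eq_2)
qed

lemma contains_C5_monochromaticE:
  fixes colour :: "'a \<Rightarrow> bool"
  assumes "contains_C5 V E"
  obtains a b c d e where "colour a = colour b" "distinct [a, b, c, d, e]"
    "{a, b} \<in> E" "{b, c} \<in> E" "{c, d} \<in> E" "{d, e} \<in> E" "{e, a} \<in> E"
proof -
  obtain a b c d e where cycle: "distinct [a, b, c, d, e]"
    "{a, b} \<in> E" "{b, c} \<in> E" "{c, d} \<in> E" "{d, e} \<in> E" "{e, a} \<in> E"
    using assms by (rule contains_C5E)
  consider (ab) "colour a = colour b" | (bc) "colour b = colour c" | (cd) "colour c = colour d"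
    | (de) "colour d = colour e" | (ea) "colour e = colour a"
    by blast
  then show thesis
  proof cases
    case ab
    then show thesis using cycle that[of a b c d e] by simp
  next
    case bc
    then show thesis using cycle that[of b c d e a] by auto
  next
    case cd
    then show thesis using cycle that[of c d e a b] by auto
  next
    case de
    then show thesis using cycle that[of d e a b c] by auto
  next
    case ea
    then show thesis using cycle that[of e a b c d] by auto
  qed
qed

subsection \<open>Layered straight-line drawings\<close>

lemma planar_graph_straight_line:
  fixes p :: "'a \<Rightarrow> complex"
  assumes "simple_graph V E" and p: "inj_on p V"
    and vertices: "\<And>a b. {a, b} \<in> E \<Longrightarrow> open_segment (p a) (p b) \<inter> p ` V = {}"
    and edges: "\<And>a b c d. \<lbrakk>{a, b} \<in> E; {c, d} \<in> E; {a, b} \<noteq> {c, d}\<rbrakk>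
      \<Longrightarrow> open_segment (p a) (p b) \<inter> open_segment (p c) (p d) = {}"
  shows "planar_graph V E"
proof -
  have E: "\<And>e. e \<in> E \<Longrightarrow> e \<subseteq> V"
    using \<open>simple_graph V E\<close> by (simp add: simple_graph_def)
  have "\<forall>e\<in>E. \<exists>a b. {a, b} = e \<and> a \<noteq> b"
    using \<open>simple_graph V E\<close> unfolding simple_graph_def card_2_iff by metis
  then obtain s t where ends: "\<And>e. e \<in> E \<Longrightarrow> {s e, t e} = e" and ne: "\<And>e. e \<in> E \<Longrightarrow> s e \<noteq> t e"
    by metis
  have p_ends: "{p (s e), p (t e)} = p ` e" if "e \<in> E" for e
    using arg_cong[OF ends[OF that], of "(`) p"] by simp
  define \<gamma> where "\<gamma> e = linepath (p (s e)) (p (t e))" for e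
  have image: "path_image (\<gamma> e) = open_segment (p (s e)) (p (t e)) \<union> p ` e" if "e \<in> E" for e
    unfolding \<gamma>_def path_image_linepath closed_segment_eq_open p_ends[OF that] ..
  have "plane_embedding V E p \<gamma>"
  proof (rule plane_embeddingI[OF \<open>simple_graph V E\<close> p])
    fix e assume e: "e \<in> E"
    have "s e \<in> V" "t e \<in> V"
      using ends[OF e] E[OF e] by blast+
    then show "arc (\<gamma> e)"
      unfolding \<gamma>_def using p ne[OF e] by (intro arc_linepath) (auto simp: inj_on_eq_iff)
    show "{pathstart (\<gamma> e), pathfinish (\<gamma> e)} = p ` e"
      using p_ends[OF e] by (simp add: \<gamma>_def)
    have "open_segment (p (s e)) (p (t e)) \<inter> p ` V = {}"
      using e by (intro vertices) (simp add: ends)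
    then show "path_image (\<gamma> e) \<inter> p ` V \<subseteq> p ` e"
      using image[OF e] by blast
  next
    fix e e' assume e: "e \<in> E" "e' \<in> E" "e \<noteq> e'"
    have "open_segment (p (s e)) (p (t e)) \<inter> open_segment (p (s e')) (p (t e')) = {}"
      using e by (intro edges) (simp_all add: ends)
    moreover have "p ` e \<subseteq> p ` V" "p ` e' \<subseteq> p ` V"
      using e E by blast+
    ultimately show "path_image (\<gamma> e) \<inter> path_image (\<gamma> e') \<subseteq> p ` V"
      unfolding image[OF e(1)] image[OF e(2)] by blast
  qed
  then show ?thesis by (auto simp: planar_graph_def)
qed

lemma open_segment_same_Re:
  assumes "z \<in> open_segment a b" and "Re a = Re b" and "Im a < Im b"
  shows "Re z = Re a" and "Im a < Im z" and "Im z < Im b"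
proof -
  obtain t where t: "0 < t" "t < 1" and z: "z = (1 - t) *\<^sub>R a + t *\<^sub>R b"
    using assms(1) by (auto simp: in_segment)
  show "Re z = Re a"
    using assms(2) by (simp add: z algebra_simps)
  have "Im z = Im a + t * (Im b - Im a)" "Im z = Im b - (1 - t) * (Im b - Im a)"
    by (simp_all add: z algebra_simps)
  moreover have "0 < t * (Im b - Im a)" "0 < (1 - t) * (Im b - Im a)"
    using t assms(3) by simp_all
  ultimately show "Im a < Im z" "Im z < Im b"
    by linarith+
qed

lemma open_segment_Re_add_oneE:
  assumes "z \<in> open_segment a b" and "Re b = Re a + 1"
  obtains t where "0 < t" "t < 1" "Re z = Re a + t" "Im z = (1 - t) * Im a + t * Im b"
proof -
  obtain t where t: "0 < t" "t < 1" and z: "z = (1 - t) *\<^sub>R a + t *\<^sub>R b"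
    using assms(1) by (auto simp: in_segment)
  have "Re z = Re a + t"
    using assms(2) by (simp add: z algebra_simps)
  with t show thesis
    by (intro that[of t]) (simp_all add: z)
qed

lemma floor_Ints_add:
  fixes m t :: real
  assumes "m \<in> \<int>" "0 \<le> t" "t < 1"
  shows "of_int \<lfloor>m + t\<rfloor> = m"
  using assms by (auto elim!: Ints_cases simp: floor_eq_iff)

lemma convex_combination_mono_eq:
  fixes t x x' y y' :: real
  assumes t: "0 < t" "t < 1" and eq: "(1 - t) * x + t * y = (1 - t) * x' + t * y'"
    and mono: "x < x' \<Longrightarrow> y \<le> y'" "x' < x \<Longrightarrow> y' \<le> y"
  shows "x = x' \<and> y = y'"
proof (cases x x' rule: linorder_cases)
  case less
  with t mono(1) have "(1 - t) * x < (1 - t) * x'" "t * y \<le> t * y'"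
    by simp_all
  with eq show ?thesis
    by linarith
next
  case equal
  with eq t show ?thesis
    by simp
next
  case greater
  with t mono(2) have "(1 - t) * x' < (1 - t) * x" "t * y' \<le> t * y"
    by simp_all
  with eq show ?thesis
    by linarith
qed

locale layered_drawing =
  fixes V :: "'a set" and E :: "'a set set" and p :: "'a \<Rightarrow> complex"
  assumes simple_graph: "simple_graph V E"
    and inj_on: "inj_on p V"
    and Re_Ints: "v \<in> V \<Longrightarrow> Re (p v) \<in> \<int>"
    and same_or_next_layer: "\<lbrakk>{a, b} \<in> E; Re (p a) \<le> Re (p b)\<rbrakk>
      \<Longrightarrow> Re (p b) = Re (p a) \<or> Re (p b) = Re (p a) + 1"
    and no_vertex_between: "\<lbrakk>{a, b} \<in> E; Re (p a) = Re (p b); v \<in> V; Re (p v) = Re (p a)\<rbrakk>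
      \<Longrightarrow> \<not> (Im (p a) < Im (p v) \<and> Im (p v) < Im (p b))"
    and order_preserving: "\<lbrakk>{a, b} \<in> E; {c, d} \<in> E; Re (p a) = Re (p c);
      Re (p b) = Re (p a) + 1; Re (p d) = Re (p c) + 1; Im (p a) < Im (p c)\<rbrakk>
      \<Longrightarrow> Im (p b) \<le> Im (p d)"
begin

lemma edge_vertices: "{a, b} \<in> E \<Longrightarrow> a \<in> V" "{a, b} \<in> E \<Longrightarrow> b \<in> V"
  using simple_graph by (auto simp: simple_graph_def)

lemma orient_edgeE:
  assumes "{a, b} \<in> E"
  obtains (vertical) c d where "{c, d} = {a, b}"
      "open_segment (p a) (p b) = open_segment (p c) (p d)"
      "Re (p c) = Re (p d)" "Im (p c) < Im (p d)"
    | (rightward) c d where "{c, d} = {a, b}"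
      "open_segment (p a) (p b) = open_segment (p c) (p d)"
      "Re (p d) = Re (p c) + 1"
proof -
  have "a \<noteq> b"
    using assms simple_graph by (auto simp: simple_graph_def)
  then have "p a \<noteq> p b"
    using edge_vertices[OF assms] inj_on by (simp add: inj_on_eq_iff)
  have "{b, a} \<in> E"
    using assms by (simp add: insert_commute)
  then consider (same) "Re (p a) = Re (p b)" | (succ) "Re (p b) = Re (p a) + 1"
    | (pred) "Re (p a) = Re (p b) + 1"
    using assms same_or_next_layer[of a b] same_or_next_layer[of b a] by linarith
  then show thesis
  proof cases
    case same
    with \<open>p a \<noteq> p b\<close> have "Im (p a) < Im (p b) \<or> Im (p b) < Im (p a)"
      by (auto simp: complex_eq_iff)
    with same show thesis
      using vertical[of a b] vertical[of b a] by (auto simp: open_segment_commute insert_commute)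
  next
    case succ
    then show thesis
      using rightward[of a b] by simp
  next
    case pred
    then show thesis
      using rightward[of b a] by (simp add: open_segment_commute insert_commute)
  qed
qed

lemma Re_rightward_not_Ints:
  assumes "{a, b} \<in> E" "Re (p b) = Re (p a) + 1" "z \<in> open_segment (p a) (p b)"
  shows "Re z \<notin> \<int>"
proof -
  obtain t where t: "0 < t" "t < 1" "Re z = Re (p a) + t"
    using assms(3,2) by (rule open_segment_Re_add_oneE)
  have "of_int \<lfloor>Re z\<rfloor> = Re (p a)"
    unfolding t(3) using t Re_Ints edge_vertices[OF assms(1)] by (intro floor_Ints_add) simp_all
  with t show ?thesis
    by (auto elim!: Ints_cases)
qed

lemma open_segment_disjoint_vertices:
  assumes "{a, b} \<in> E"
  shows "open_segment (p a) (p b) \<inter> p ` V = {}"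
  using assms
proof (cases rule: orient_edgeE)
  case (vertical c d)
  then have "{c, d} \<in> E"
    using assms by simp
  then have "p v \<notin> open_segment (p c) (p d)" if "v \<in> V" for v
    using no_vertex_between[of c d v] open_segment_same_Re[of "p v" "p c" "p d"] vertical that
    by auto
  then show ?thesis
    unfolding vertical(2) by auto
next
  case (rightward c d)
  then have "{c, d} \<in> E"
    using assms by simp
  then have "p v \<notin> open_segment (p c) (p d)" if "v \<in> V" for v
    using Re_rightward_not_Ints rightward(3) Re_Ints that by blast
  then show ?thesis
    unfolding rightward(2) by auto
qed

lemma vertical_edges_disjoint:
  assumes edges: "{a, b} \<in> E" "{c, d} \<in> E"
    and vertical: "Re (p a) = Re (p b)" "Im (p a) < Im (p b)"
      "Re (p c) = Re (p d)" "Im (p c) < Im (p d)"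
    and "(a, b) \<noteq> (c, d)"
  shows "open_segment (p a) (p b) \<inter> open_segment (p c) (p d) = {}"
proof (rule equals0I)
  fix z assume "z \<in> open_segment (p a) (p b) \<inter> open_segment (p c) (p d)"
  then have z: "z \<in> open_segment (p a) (p b)" "z \<in> open_segment (p c) (p d)"
    by simp_all
  have V: "a \<in> V" "b \<in> V" "c \<in> V" "d \<in> V"
    using edges edge_vertices by blast+
  have same_layer: "Re (p a) = Re (p c)" and overlap: "Im (p a) < Im (p d)" "Im (p c) < Im (p b)"
    using open_segment_same_Re[OF z(1) vertical(1,2)] open_segment_same_Re[OF z(2) vertical(3,4)]
    by simp_all
  have "\<not> Im (p a) < Im (p c)" "\<not> Im (p d) < Im (p b)"
    using no_vertex_between[OF edges(1) vertical(1)] V same_layer overlap vertical by auto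
  moreover have "\<not> Im (p c) < Im (p a)" "\<not> Im (p b) < Im (p d)"
    using no_vertex_between[OF edges(2) vertical(3)] V same_layer overlap vertical by auto
  ultimately have "p a = p c" "p b = p d"
    using same_layer vertical(1,3) by (simp_all add: complex_eq_iff)
  then show False
    using V \<open>(a, b) \<noteq> (c, d)\<close> by (simp add: inj_on_eq_iff[OF inj_on])
qed

lemma rightward_edges_disjoint:
  assumes edges: "{a, b} \<in> E" "{c, d} \<in> E"
    and rightward: "Re (p b) = Re (p a) + 1" "Re (p d) = Re (p c) + 1"
    and "(a, b) \<noteq> (c, d)"
  shows "open_segment (p a) (p b) \<inter> open_segment (p c) (p d) = {}"
proof (rule equals0I)
  fix z assume "z \<in> open_segment (p a) (p b) \<inter> open_segment (p c) (p d)"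
  then have z: "z \<in> open_segment (p a) (p b)" "z \<in> open_segment (p c) (p d)"
    by simp_all
  have V: "a \<in> V" "b \<in> V" "c \<in> V" "d \<in> V"
    using edges edge_vertices by blast+
  obtain t where t: "0 < t" "t < 1" "Re z = Re (p a) + t" "Im z = (1 - t) * Im (p a) + t * Im (p b)"
    using z(1) rightward(1) by (rule open_segment_Re_add_oneE)
  obtain s where s: "0 < s" "s < 1" "Re z = Re (p c) + s" "Im z = (1 - s) * Im (p c) + s * Im (p d)"
    using z(2) rightward(2) by (rule open_segment_Re_add_oneE)
  have "of_int \<lfloor>Re z\<rfloor> = Re (p a)"
    unfolding t(3) using V Re_Ints t by (intro floor_Ints_add) simp_all
  moreover have "of_int \<lfloor>Re z\<rfloor> = Re (p c)"
    unfolding s(3) using V Re_Ints s by (intro floor_Ints_add) simp_all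
  ultimately have same_layer: "Re (p a) = Re (p c)"
    by simp
  with t s have "s = t"
    by simp
  then have "Im (p a) = Im (p c) \<and> Im (p b) = Im (p d)"
    using t s order_preserving[OF edges] order_preserving[OF edges(2,1)] same_layer rightward
    by (intro convex_combination_mono_eq[of t]) simp_all
  then have "p a = p c" "p b = p d"
    using same_layer rightward by (simp_all add: complex_eq_iff)
  then show False
    using V \<open>(a, b) \<noteq> (c, d)\<close> by (simp add: inj_on_eq_iff[OF inj_on])
qed

lemma vertical_rightward_edges_disjoint:
  assumes edges: "{a, b} \<in> E" "{c, d} \<in> E"
    and vertical: "Re (p a) = Re (p b)" "Im (p a) < Im (p b)"
    and rightward: "Re (p d) = Re (p c) + 1"
  shows "open_segment (p a) (p b) \<inter> open_segment (p c) (p d) = {}"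
proof (rule equals0I)
  fix z assume "z \<in> open_segment (p a) (p b) \<inter> open_segment (p c) (p d)"
  then have "Re z = Re (p a)" "Re z \<notin> \<int>"
    using open_segment_same_Re(1) vertical Re_rightward_not_Ints[OF edges(2) rightward] by auto
  then show False
    using Re_Ints edge_vertices(1)[OF edges(1)] by simp
qed

lemma open_segments_disjoint:
  assumes edges: "{a, b} \<in> E" "{c, d} \<in> E" and "{a, b} \<noteq> {c, d}"
  shows "open_segment (p a) (p b) \<inter> open_segment (p c) (p d) = {}"
  using edges(1)
proof (cases rule: orient_edgeE)
  case ab: (vertical a' b')
  show ?thesis
    using edges(2)
  proof (cases rule: orient_edgeE)
    case (vertical c' d')
    then show ?thesis
      unfolding ab(2) vertical(2) using ab assms by (intro vertical_edges_disjoint) auto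
  next
    case (rightward c' d')
    then show ?thesis
      unfolding ab(2) rightward(2) using ab edges
      by (intro vertical_rightward_edges_disjoint) simp_all
  qed
next
  case ab: (rightward a' b')
  show ?thesis
    using edges(2)
  proof (cases rule: orient_edgeE)
    case (vertical c' d')
    then have "open_segment (p c') (p d') \<inter> open_segment (p a') (p b') = {}"
      using ab edges by (intro vertical_rightward_edges_disjoint) simp_all
    then show ?thesis
      unfolding ab(2) vertical(2) by (simp add: Int_commute)
  next
    case (rightward c' d')
    then show ?thesis
      unfolding ab(2) rightward(2) using ab assms by (intro rightward_edges_disjoint) auto
  qed
qed

lemma planar_graph: "planar_graph V E"
  using simple_graph inj_on open_segment_disjoint_vertices open_segments_disjoint
  by (rule planar_graph_straight_line)

end

subsection \<open>Rings of diamonds glued at two vertices\<close>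

datatype vertex = Source | Near nat nat | Far nat nat | Sink

definition diamond :: "'a \<Rightarrow> 'a \<Rightarrow> 'a \<Rightarrow> 'a \<Rightarrow> 'a set set" where
  "diamond a b c d = {{a, c}, {a, d}, {b, c}, {b, d}, {c, d}}"

definition ring_vertices :: "nat \<Rightarrow> vertex set" where
  "ring_vertices j = {Near j 0, Near j 1, Near j 2, Near j 3, Far j 0, Far j 1, Far j 2}"

definition ring_edges :: "nat \<Rightarrow> vertex set set" where
  "ring_edges j =
     diamond Source (Far j 0) (Near j 0) (Near j 1) \<union>
     diamond Source (Far j 2) (Near j 2) (Near j 3) \<union>
     diamond (Far j 0) (Far j 2) (Far j 1) Sink"

definition glued_rings_vertices :: "nat \<Rightarrow> vertex set" where
  "glued_rings_vertices k = {Source, Sink} \<union> (\<Union>j<k. ring_vertices j)"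

definition glued_rings_edges :: "nat \<Rightarrow> vertex set set" where
  "glued_rings_edges k = (\<Union>j<k. ring_edges j)"

lemmas glued_rings_edges_defs = glued_rings_edges_def ring_edges_def diamond_def

lemma card_ring_vertices: "card (ring_vertices j) = 7"
  by (simp add: ring_vertices_def)

lemma card_ring_edges: "card (ring_edges j) = 15"
  by (simp add: ring_edges_def diamond_def doubleton_eq_iff)

lemma card_glued_rings_vertices: "card (glued_rings_vertices k) = 7 * k + 2"
proof -
  have "ring_vertices i \<inter> ring_vertices j = {}" if "i \<noteq> j" for i j
    using that by (auto simp: ring_vertices_def)
  then have "card (\<Union>j<k. ring_vertices j) = (\<Sum>j<k. card (ring_vertices j))"
    by (intro card_UN_disjoint) (auto simp: ring_vertices_def)
  moreover have "card (glued_rings_vertices k) = card {Source, Sink} + card (\<Union>j<k. ring_vertices j)"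
    unfolding glued_rings_vertices_def by (intro card_Un_disjoint) (auto simp: ring_vertices_def)
  ultimately show ?thesis
    by (simp add: card_ring_vertices)
qed

lemma card_glued_rings_edges: "card (glued_rings_edges k) = 15 * k"
proof -
  have "ring_edges i \<inter> ring_edges j = {}" if "i \<noteq> j" for i j
    using that by (simp add: ring_edges_def diamond_def doubleton_eq_iff disjoint_iff)
  then have "card (glued_rings_edges k) = (\<Sum>j<k. card (ring_edges j))"
    unfolding glued_rings_edges_def
    by (intro card_UN_disjoint) (auto simp: ring_edges_def diamond_def)
  then show ?thesis
    by (simp add: card_ring_edges)
qed

lemma simple_graph_glued_rings: "simple_graph (glued_rings_vertices k) (glued_rings_edges k)"
proof -
  have "e \<subseteq> {Source, Sink} \<union> ring_vertices j \<and> card e = 2" if "e \<in> ring_edges j" for e j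
    using that by (auto simp: ring_edges_def diamond_def ring_vertices_def)
  moreover have "finite (glued_rings_vertices k)"
    by (simp add: glued_rings_vertices_def ring_vertices_def)
  ultimately show ?thesis
    unfolding simple_graph_def glued_rings_edges_def glued_rings_vertices_def by blast
qed

primrec position :: "vertex \<Rightarrow> complex" where
  "position Source = Complex 0 0"
| "position (Near j i) = Complex 1 (real (4 * j + i))"
| "position (Far j i) = Complex 2 (real (4 * j + i))"
| "position Sink = Complex 3 0"

lemma vertical_glued_rings_edge:
  assumes "{a, b} \<in> glued_rings_edges k" "Re (position a) = Re (position b)"
  shows "\<bar>Im (position b) - Im (position a)\<bar> = 1"
  using assms by (auto simp: glued_rings_edges_defs doubleton_eq_iff)

lemma rightward_glued_rings_edgeE:
  assumes "{a, b} \<in> glued_rings_edges k" "Re (position b) = Re (position a) + 1"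
  obtains (Source) j i where "a = Source" "b = Near j i"
    | (Near) j i where "a = Near j i" "b = Far j (2 * (i div 2))"
    | (Sink) j i where "a = Far j i" "b = Sink"
proof -
  have "(\<exists>j i. a = Source \<and> b = Near j i) \<or>
      (\<exists>j. \<exists>i\<in>{0, 1, 2, 3}. a = Near j i \<and> b = Far j (2 * (i div 2))) \<or>
      (\<exists>j i. a = Far j i \<and> b = Sink)"
    using assms by (auto simp: glued_rings_edges_defs doubleton_eq_iff)
  then show thesis
    using Source Near Sink by auto
qed

lemma Re_position_Ints: "Re (position v) \<in> \<int>"
  by (cases v) simp_all

lemma Im_position_Ints: "Im (position v) \<in> \<int>"
  by (cases v) simp_all

lemma inj_on_position: "inj_on position (glued_rings_vertices k)"
proof (rule inj_onI)
  have digits: "j = j' \<and> i = i'" if "4 * j + i = 4 * j' + i'" "i < 4" "i' < 4" for i j i' j' :: nat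
    using that by presburger
  have index: "(\<forall>j i. v = Near j i \<or> v = Far j i \<longrightarrow> i < 4)" if "v \<in> glued_rings_vertices k" for v
    using that by (auto simp: glued_rings_vertices_def ring_vertices_def)
  fix u v assume "u \<in> glued_rings_vertices k" "v \<in> glued_rings_vertices k" "position u = position v"
  with index[of u] index[of v] show "u = v"
    by (cases u; cases v) (auto dest!: digits simp del: of_nat_add of_nat_mult)
qed

lemma rightward_glued_rings_edges_order_preserving:
  assumes edges: "{a, b} \<in> glued_rings_edges k" "{c, d} \<in> glued_rings_edges k"
    and rightward: "Re (position b) = Re (position a) + 1" "Re (position d) = Re (position c) + 1"
    and same_layer: "Re (position a) = Re (position c)"
    and less: "Im (position a) < Im (position c)"
  shows "Im (position b) \<le> Im (position d)"
  using edges(1) rightward(1)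
proof (cases rule: rightward_glued_rings_edgeE)
  case (Source j i)
  show ?thesis
    using edges(2) rightward(2)
    by (cases rule: rightward_glued_rings_edgeE) (use Source same_layer less in auto)
next
  case (Near j i)
  with edges(2) rightward(2) same_layer
  obtain j' i' where cd: "c = Near j' i'" "d = Far j' (2 * (i' div 2))"
    by (cases rule: rightward_glued_rings_edgeE) auto
  then have "4 * j + i < 4 * j' + i'"
    using Near less by (simp del: of_nat_add of_nat_mult)
  then have "4 * j + 2 * (i div 2) \<le> 4 * j' + 2 * (i' div 2)"
    by presburger
  then show ?thesis
    using Near cd by (simp del: of_nat_add of_nat_mult)
next
  case (Sink j i)
  show ?thesis
    using edges(2) rightward(2)
    by (cases rule: rightward_glued_rings_edgeE) (use Sink same_layer in auto)
qed

lemma layered_drawing_glued_rings: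
  "layered_drawing (glued_rings_vertices k) (glued_rings_edges k) position"
proof
  fix a b assume "{a, b} \<in> glued_rings_edges k" "Re (position a) \<le> Re (position b)"
  then show "Re (position b) = Re (position a) \<or> Re (position b) = Re (position a) + 1"
    by (auto simp: glued_rings_edges_defs doubleton_eq_iff)
next
  fix a b v assume "{a, b} \<in> glued_rings_edges k" "Re (position a) = Re (position b)"
  then have "\<bar>Im (position b) - Im (position a)\<bar> = 1"
    by (rule vertical_glued_rings_edge)
  then show "\<not> (Im (position a) < Im (position v) \<and> Im (position v) < Im (position b))"
    using Ints_eq_abs_less1[OF Im_position_Ints Im_position_Ints, of v a] by linarith
qed (blast intro: simple_graph_glued_rings inj_on_position Re_position_Ints
    rightward_glued_rings_edges_order_preserving)+

lemma glued_rings_neighbours: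
  "{Source, v} \<in> glued_rings_edges k \<longleftrightarrow> (\<exists>j<k. v \<in> {Near j 0, Near j 1, Near j 2, Near j 3})"
  "{Sink, v} \<in> glued_rings_edges k \<longleftrightarrow> (\<exists>j<k. v \<in> {Far j 0, Far j 1, Far j 2})"
  "{Near j 0, v} \<in> glued_rings_edges k \<longleftrightarrow> j < k \<and> v \<in> {Source, Near j 1, Far j 0}"
  "{Near j 1, v} \<in> glued_rings_edges k \<longleftrightarrow> j < k \<and> v \<in> {Source, Near j 0, Far j 0}"
  "{Near j 2, v} \<in> glued_rings_edges k \<longleftrightarrow> j < k \<and> v \<in> {Source, Near j 3, Far j 2}"
  "{Near j 3, v} \<in> glued_rings_edges k \<longleftrightarrow> j < k \<and> v \<in> {Source, Near j 2, Far j 2}"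
  "{Far j 0, v} \<in> glued_rings_edges k \<longleftrightarrow> j < k \<and> v \<in> {Near j 0, Near j 1, Far j 1, Sink}"
  "{Far j 1, v} \<in> glued_rings_edges k \<longleftrightarrow> j < k \<and> v \<in> {Far j 0, Far j 2, Sink}"
  "{Far j 2, v} \<in> glued_rings_edges k \<longleftrightarrow> j < k \<and> v \<in> {Near j 2, Near j 3, Far j 1, Sink}"
  by (auto simp: glued_rings_edges_defs doubleton_eq_iff)

primrec colour :: "vertex \<Rightarrow> bool" where
  "colour Source = False"
| "colour (Near j i) = True"
| "colour (Far j i) = (i = 1)"
| "colour Sink = True"

definition diagonals :: "nat \<Rightarrow> vertex set set" where
  "diagonals j = {{Near j 0, Near j 1}, {Near j 2, Near j 3}, {Far j 1, Sink}}"

lemma monochromatic_edge_in_diagonals: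
  assumes "{a, b} \<in> glued_rings_edges k" "colour a = colour b"
  shows "\<exists>j. {a, b} \<in> diagonals j"
  using assms by (auto simp: glued_rings_edges_defs diagonals_def doubleton_eq_iff)

lemma diagonal_neighbours_not_adjacent:
  assumes "{a, b} \<in> diagonals j"
    and "{a, x} \<in> glued_rings_edges k" "x \<noteq> b" and "{b, y} \<in> glued_rings_edges k" "y \<noteq> a"
    and "x \<noteq> y"
  shows "{x, y} \<notin> glued_rings_edges k"
  using assms
  by (auto simp: diagonals_def doubleton_eq_iff glued_rings_neighbours simp del: One_nat_def)

lemma diagonal_neighbours_common_neighbour:
  assumes "{a, b} \<in> diagonals j"
    and "{a, x} \<in> glued_rings_edges k" "x \<noteq> b" and "{b, y} \<in> glued_rings_edges k" "y \<noteq> a"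
    and "x \<noteq> y" and "{x, z} \<in> glued_rings_edges k" "{y, z} \<in> glued_rings_edges k"
  shows "z = a \<or> z = b"
  using assms
  by (auto simp: diagonals_def doubleton_eq_iff glued_rings_neighbours simp del: One_nat_def)

lemma not_contains_K4_glued_rings: "\<not> contains_K4 (glued_rings_vertices k) (glued_rings_edges k)"
proof
  assume "contains_K4 (glued_rings_vertices k) (glued_rings_edges k)"
  then obtain a b x y where "colour a = colour b" and "distinct [a, b, x, y]"
    and "{a, b} \<in> glued_rings_edges k" "{a, x} \<in> glued_rings_edges k"
      "{b, y} \<in> glued_rings_edges k" "{x, y} \<in> glued_rings_edges k"
    by (rule contains_K4_monochromaticE)
  moreover then obtain j where "{a, b} \<in> diagonals j"
    using monochromatic_edge_in_diagonals by blast
  ultimately show False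
    using diagonal_neighbours_not_adjacent[of a b j x k y] by auto
qed

lemma not_contains_C5_glued_rings: "\<not> contains_C5 (glued_rings_vertices k) (glued_rings_edges k)"
proof
  assume "contains_C5 (glued_rings_vertices k) (glued_rings_edges k)"
  then obtain a b c d e where "colour a = colour b" and distinct: "distinct [a, b, c, d, e]"
    and edges: "{a, b} \<in> glued_rings_edges k" "{b, c} \<in> glued_rings_edges k"
      "{c, d} \<in> glued_rings_edges k" "{d, e} \<in> glued_rings_edges k" "{e, a} \<in> glued_rings_edges k"
    by (rule contains_C5_monochromaticE)
  then obtain j where "{a, b} \<in> diagonals j"
    using monochromatic_edge_in_diagonals by blast
  moreover have "{a, e} \<in> glued_rings_edges k" "{e, d} \<in> glued_rings_edges k"
    using edges by (simp_all add: insert_commute)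
  ultimately have "d = a \<or> d = b"
    using diagonal_neighbours_common_neighbour[of a b j e k c d] edges distinct by auto
  then show False
    using distinct by auto
qed

lemma planar_graph_glued_rings: "planar_graph (glued_rings_vertices k) (glued_rings_edges k)"
  using layered_drawing_glued_rings by (rule layered_drawing.planar_graph)

theorem theorem2:
  fixes n :: nat
  assumes "n \<ge> 9" and "n mod 7 = 2"
  shows "\<exists>(V :: nat set) (E :: nat set set).
           simple_graph V E \<and> planar_graph V E \<and> card V = n \<and>
           \<not> contains_K4 V E \<and> \<not> contains_C5 V E \<and>
           real (card E) = 15 / 7 * (real n - 2)"
proof -
  obtain k where n: "n = 7 * k + 2"
    using assms(2) by (metis mult_div_mod_eq)
  obtain V :: "nat set" and E f where "simple_graph V E"
    and card: "card V = 7 * k + 2" "card E = 15 * k"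
    and f: "graph_embedding f V E (glued_rings_vertices k) (glued_rings_edges k)"
    using ex_graph_embedding_nat[OF simple_graph_glued_rings[of k]]
    by (metis card_glued_rings_vertices card_glued_rings_edges)
  have "planar_graph V E"
    using f \<open>simple_graph V E\<close> planar_graph_glued_rings by (rule graph_embedding_planar_graph)
  moreover have "\<not> contains_K4 V E" "\<not> contains_C5 V E"
    using f graph_embedding_contains_K4 graph_embedding_contains_C5
      not_contains_K4_glued_rings not_contains_C5_glued_rings by blast+
  moreover have "real (card E) = 15 / 7 * (real n - 2)"
    by (simp add: card n)
  ultimately show ?thesis
    using \<open>simple_graph V E\<close> card(1) n by blast
qed

end
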